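(* Consider the MaximumProtocol described in the context, run with parameter $N\ge n$ by $n$ nodes holding pairwise distinct values. The expected number of messages sent by the nodes to the coordinator is at most $2\log N+1$, and for every fixed $c>1$ this number is $O(\log N)$ with probability at least $1-N^{-c}$.
   Context: MaximumProtocol with parameter $N\ge n$ (logarithms are base 2): initially all nodes are active, and $max_{-1}=-\infty$. For rounds $r=0,1,\dots,\log N$: each active node $i$ with $v_i<max_{r-1}$ does nothing this round; every other active node independently flips a coin with success probability $2^r/N$ and on success sends $(i,v_i)$ to the coordinator and becomes inactive. At the end of round $r$ the coordinator broadcasts the maximum $max_r$ of all values it has received so far. *)

theory Defs
  imports "HOL-Probability.Probability" "HOL-Library.Multiset"
begin

text \<open>
  The nodes are \<open>1, \<dots>, n\<close> and node \<open>i\<close> holds the value \<open>v i\<close>. The multiset \<open>received\<close> collects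
  every message \<open>(i, v i)\<close> that has reached the coordinator, so its size is the number of messages.
\<close>

record state =
  active :: "nat set"
  received :: "(nat \<times> real) multiset"

definition initial_state :: "nat \<Rightarrow> state" where
  "initial_state n = \<lparr>active = {1..n}, received = {#}\<rparr>"

definition broadcast_max :: "state \<Rightarrow> ereal" where
  "broadcast_max s = Max (insert (-\<infinity>) ((\<lambda>m. ereal (snd m)) ` set_mset (received s)))"

definition flipping :: "(nat \<Rightarrow> real) \<Rightarrow> state \<Rightarrow> nat set" where
  "flipping v s = {i \<in> active s. \<not> ereal (v i) < broadcast_max s}"

definition send :: "(nat \<Rightarrow> real) \<Rightarrow> nat set \<Rightarrow> state \<Rightarrow> state" where
  "send v S s =
     \<lparr>active = active s - S,
      received = received s + image_mset (\<lambda>i. (i, v i)) (mset_set S)\<rparr>"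

definition maximum_round :: "nat \<Rightarrow> (nat \<Rightarrow> real) \<Rightarrow> nat \<Rightarrow> state \<Rightarrow> state pmf" where
  "maximum_round N v r s =
     map_pmf (\<lambda>coin. send v {i \<in> flipping v s. coin i} s)
       (Pi_pmf (flipping v s) False (\<lambda>_. bernoulli_pmf (2 ^ r / real N)))"

text \<open>The state after rounds \<open>0, \<dots>, k - 1\<close>.\<close>

primrec run_rounds :: "nat \<Rightarrow> nat \<Rightarrow> (nat \<Rightarrow> real) \<Rightarrow> nat \<Rightarrow> state pmf" where
  "run_rounds N n v 0 = return_pmf (initial_state n)"
| "run_rounds N n v (Suc r) = bind_pmf (run_rounds N n v r) (maximum_round N v r)"

text \<open>
  The rounds are the natural numbers \<open>r \<le> log 2 N\<close>; \<open>N\<close> need not be a power of two. In all of them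
  \<open>2 ^ r / N \<le> 1\<close>, so that \<^const>\<open>bernoulli_pmf\<close> never truncates its parameter.
\<close>

definition maximum_protocol :: "nat \<Rightarrow> nat \<Rightarrow> (nat \<Rightarrow> real) \<Rightarrow> state pmf" where
  "maximum_protocol N n v = run_rounds N n v (Suc (nat \<lfloor>log 2 (real N)\<rfloor>))"

definition messages :: "state \<Rightarrow> nat" where
  "messages s = size (received s)"

text \<open>
  The support is finite, so the number of messages is integrable and its expectation is never the
  default value of a Bochner integral.
\<close>

lemma run_rounds_finite:
  "finite (set_pmf (run_rounds N n v k)) \<and> (\<forall>s\<in>set_pmf (run_rounds N n v k). finite (active s))"
proof (induction k)
  case 0
  then show ?case by (simp add: initial_state_def)
next
  case (Suc k)
  have fin: "finite (set_pmf (maximum_round N v k s))" if "finite (active s)" for s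
  proof -
    have "set_pmf (maximum_round N v k s) \<subseteq> (\<lambda>S. send v S s) ` Pow (flipping v s)"
      by (auto simp: maximum_round_def)
    moreover have "finite (flipping v s)"
      using that by (simp add: flipping_def)
    ultimately show ?thesis
      by (meson finite_Pow_iff finite_imageI finite_subset)
  qed
  have act: "finite (active t)" if "finite (active s)" "t \<in> set_pmf (maximum_round N v k s)" for s t
    using that by (auto simp: maximum_round_def send_def)
  show ?case using Suc.IH fin act by auto
qed

lemma integrable_messages:
  "integrable (measure_pmf (maximum_protocol N n v)) (\<lambda>s. real (messages s))"
  unfolding maximum_protocol_def
  by (rule integrable_measure_pmf_finite) (use run_rounds_finite in blast)

end

theory Submission
  imports Defs
begin

text \<open>
  Let \<open>p = 2 ^ r / N\<close> be the success probability of round \<open>r\<close> and \<open>F\<close> the set of nodes that flip a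
  coin in it. The nodes that flip again in the next round are exactly those above the largest
  successful node, so their number is a truncated geometric variable with mean at most \<open>1 / p\<close>.
  As the success probability then doubles to \<open>2 * p\<close>, a potential argument works: the potential
  \<open>messages + p * card F\<close> grows by at most \<open>2\<close> per round in expectation, and the exponential
  potential \<open>(3 / 2) ^ messages * (1 + p / 2) ^ card F\<close> at most triples per round in expectation.
  The tail bound is Markov's inequality for the latter.
\<close>

section \<open>Independent random subsets, and the elements above them\<close>

definition random_subset :: "'a set \<Rightarrow> real \<Rightarrow> 'a set pmf" where
  "random_subset F p = map_pmf (\<lambda>coin. {i \<in> F. coin i}) (Pi_pmf F False (\<lambda>_. bernoulli_pmf p))"

text \<open>Quantifying over \<open>S\<close> instead of comparing with its maximum covers
  \<open>S = {}\<close>: the result is then all of \<open>F\<close>, as it should be when nobody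
  succeeds.\<close>

definition above :: "('a \<Rightarrow> 'b::linorder) \<Rightarrow> 'a set \<Rightarrow> 'a set \<Rightarrow> 'a set" where
  "above v F S = {i \<in> F. \<forall>j\<in>S. v j < v i}"

lemma set_random_subset: "set_pmf (random_subset F p) \<subseteq> Pow F"
  by (auto simp: random_subset_def)

lemma finite_set_random_subset: "finite F \<Longrightarrow> finite (set_pmf (random_subset F p))"
  by (meson finite_Pow_iff finite_subset set_random_subset)

lemma integrable_random_subset:
  fixes g :: "'a set \<Rightarrow> real"
  shows "finite F \<Longrightarrow> integrable (measure_pmf (random_subset F p)) g"
  by (intro integrable_measure_pmf_finite finite_set_random_subset)

lemma card_insert_random_subset:
  assumes "finite A" "x \<notin> A" "S \<in> set_pmf (random_subset A p)"
  shows "card (insert x S) = Suc (card S)"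
proof -
  have "S \<subseteq> A"
    using assms(3) set_random_subset by blast
  then show ?thesis
    using assms(1,2) finite_subset by (subst card_insert_disjoint) auto
qed

lemma random_subset_empty: "random_subset {} p = return_pmf {}"
  by (simp add: random_subset_def)

section \<open>Expectations over finitely supported distributions\<close>

lemma expectation_pmf_cong:
  fixes f g :: "'a \<Rightarrow> real"
  assumes "\<And>x. x \<in> set_pmf M \<Longrightarrow> f x = g x"
  shows "measure_pmf.expectation M f = measure_pmf.expectation M g"
  using assms by (intro integral_cong_AE) (auto simp: AE_measure_pmf_iff)

lemma expectation_pmf_mono:
  fixes f g :: "'a \<Rightarrow> real"
  assumes "finite (set_pmf M)" "\<And>x. x \<in> set_pmf M \<Longrightarrow> f x \<le> g x"
  shows "measure_pmf.expectation M f \<le> measure_pmf.expectation M g"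
  using assms by (intro integral_mono_AE integrable_measure_pmf_finite) (auto simp: AE_measure_pmf_iff)

text \<open>Tower rule as an inequality: it lifts a bound for one round from a fixed state to the
  whole run.\<close>

lemma expectation_bind_pmf_le:
  fixes g :: "'a \<Rightarrow> real" and h :: "'b \<Rightarrow> real"
  assumes fin: "finite (set_pmf M)" "\<And>x. x \<in> set_pmf M \<Longrightarrow> finite (set_pmf (K x))"
    and le: "\<And>x. x \<in> set_pmf M \<Longrightarrow> measure_pmf.expectation (K x) h \<le> g x"
  shows "measure_pmf.expectation (bind_pmf M K) h \<le> measure_pmf.expectation M g"
proof -
  have "measure_pmf.expectation (bind_pmf M K) h
      = (\<Sum>x\<in>set_pmf M. pmf M x *\<^sub>R measure_pmf.expectation (K x) h)"
    by (rule pmf_expectation_bind) (use fin in auto)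
  also have "\<dots> \<le> (\<Sum>x\<in>set_pmf M. pmf M x *\<^sub>R g x)"
    by (intro sum_mono scaleR_left_mono le) auto
  also have "\<dots> = measure_pmf.expectation M g"
    by (subst integral_measure_pmf[of "set_pmf M"]) (use fin in auto)
  finally show ?thesis .
qed

text \<open>Conditions on the coin of \<open>x\<close>, which is independent of the coins in
  \<open>A\<close>. All expectations over random subsets below are computed by induction with this
  recursion.\<close>

lemma expectation_random_subset_insert:
  fixes g :: "'a set \<Rightarrow> real"
  assumes "finite A" "x \<notin> A" "0 \<le> p" "p \<le> 1"
  shows "measure_pmf.expectation (random_subset (insert x A) p) g
     = p * measure_pmf.expectation (random_subset A p) (\<lambda>S. g (insert x S))
       + (1 - p) * measure_pmf.expectation (random_subset A p) g"
proof -
  let ?Q = "Pi_pmf A False (\<lambda>_. bernoulli_pmf p)"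
  have eq: "random_subset (insert x A) p = bernoulli_pmf p \<bind>
      (\<lambda>b. map_pmf (if b then insert x else id) (random_subset A p))"
    unfolding random_subset_def
    by (subst Pi_pmf_insert'[OF assms(1,2)])
       (use assms(2) in \<open>auto simp: map_bind_pmf map_pmf_def[symmetric] pmf.map_comp o_def
          intro!: bind_pmf_cong map_pmf_cong split: if_splits\<close>)
  show ?thesis
    unfolding eq
    by (subst pmf_expectation_bind[of UNIV])
       (use assms finite_set_random_subset[OF assms(1), of p] in \<open>auto simp: UNIV_bool\<close>)
qed

lemma expectation_card_random_subset:
  assumes "finite F" "0 \<le> p" "p \<le> 1"
  shows "measure_pmf.expectation (random_subset F p) (\<lambda>S. real (card S)) = p * real (card F)"
  using assms(1)
proof induction
  case empty
  then show ?case by (simp add: random_subset_empty)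
next
  case (insert x A)
  have "measure_pmf.expectation (random_subset A p) (\<lambda>S. real (card (insert x S)))
      = measure_pmf.expectation (random_subset A p) (\<lambda>S. 1 + real (card S))"
    by (rule expectation_pmf_cong) (simp add: card_insert_random_subset[OF insert.hyps(1,2)])
  then show ?case
    using insert assms(2,3)
    by (simp add: expectation_random_subset_insert integrable_random_subset algebra_simps)
qed

text \<open>The probability generating function of the binomial distribution.\<close>

lemma expectation_power_card_random_subset:
  assumes "finite F" "0 \<le> p" "p \<le> 1"
  shows "measure_pmf.expectation (random_subset F p) (\<lambda>S. z ^ card S) = (1 + p * (z - 1)) ^ card F"
  using assms(1)
proof induction
  case empty
  then show ?case by (simp add: random_subset_empty)
next
  case (insert x A)
  have "measure_pmf.expectation (random_subset A p) (\<lambda>S. z ^ card (insert x S))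
      = measure_pmf.expectation (random_subset A p) (\<lambda>S. z * z ^ card S)"
    by (rule expectation_pmf_cong) (simp add: card_insert_random_subset[OF insert.hyps(1,2)])
  then show ?case
    using insert assms(2,3)
    by (simp add: expectation_random_subset_insert algebra_simps)
qed

section \<open>Expected number of nodes above all successes\<close>

text \<open>Each step adds a new greatest element, because the effect of its coin is simple: success
  leaves nothing above, failure merely adds this element to what was above already. Injectivity
  turns the weak inequality of the ranking induction into a strict one.\<close>

lemma inj_on_max_induct [consumes 2, case_names empty insert]:
  fixes v :: "'a \<Rightarrow> 'b::linorder"
  assumes "finite F" "inj_on v F" "P {}"
    and step: "\<And>x A. finite A \<Longrightarrow> x \<notin> A \<Longrightarrow> (\<And>y. y \<in> A \<Longrightarrow> v y < v x) \<Longrightarrow> P A \<Longrightarrow> P (insert x A)"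
  shows "P F"
  using assms(1,2)
proof (induction F rule: finite_ranking_induct[where f = v])
  case empty
  then show ?case using assms(3) by simp
next
  case (insert x S)
  show ?case
  proof (cases "x \<in> S")
    case True
    then show ?thesis using insert by (simp add: insert_absorb)
  next
    case False
    have "v y < v x" if "y \<in> S" for y
      using insert that False by (metis inj_on_contraD insertCI order_le_imp_less_or_eq)
    then show ?thesis
      using step[of S x] insert False by (simp add: inj_on_insert)
  qed
qed

lemma above_insert_max:
  assumes "\<And>y. y \<in> A \<Longrightarrow> v y < v x" "S \<subseteq> A"
  shows "above v (insert x A) (insert x S) = {}" "above v (insert x A) S = insert x (above v A S)"
  using assms by (auto simp: above_def dest: less_asym)

lemma card_above_insert_max:
  assumes "finite A" "x \<notin> A" "\<And>y. y \<in> A \<Longrightarrow> v y < v x" "S \<subseteq> A"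
  shows "card (above v (insert x A) S) = Suc (card (above v A S))"
  using assms by (subst above_insert_max(2)) (auto simp: above_def)

text \<open>If \<open>e\<close> is the mean for \<open>A\<close>, adding a new maximum gives
  \<open>(1 - p) * (1 + e)\<close>. With \<open>p * e \<le> 1\<close>, multiplying by
  \<open>p\<close> yields at most \<open>(1 - p) * (1 + p) = 1 - p * p\<close>.\<close>

lemma expectation_card_above:
  assumes "finite F" "inj_on v F" "0 \<le> p" "p \<le> 1"
  shows "p * measure_pmf.expectation (random_subset F p) (\<lambda>S. real (card (above v F S))) \<le> 1"
  using assms(1,2)
proof (induction rule: inj_on_max_induct)
  case empty
  then show ?case by (simp add: random_subset_empty above_def)
next
  case (insert x A)
  let ?E = "measure_pmf.expectation (random_subset A p)"
  let ?e = "?E (\<lambda>S. real (card (above v A S)))"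
  have sub: "S \<subseteq> A" if "S \<in> set_pmf (random_subset A p)" for S
    using that set_random_subset by blast
  have "?E (\<lambda>S. real (card (above v (insert x A) (insert x S)))) = ?E (\<lambda>S. 0)"
    by (rule expectation_pmf_cong) (simp add: above_insert_max(1) insert.hyps sub)
  moreover have "?E (\<lambda>S. real (card (above v (insert x A) S))) = ?E (\<lambda>S. 1 + real (card (above v A S)))"
    by (rule expectation_pmf_cong) (simp add: card_above_insert_max insert.hyps sub)
  ultimately have "measure_pmf.expectation (random_subset (insert x A) p)
      (\<lambda>S. real (card (above v (insert x A) S))) = (1 - p) * (1 + ?e)" (is "?e' = _")
    using insert.hyps assms(3,4)
    by (simp add: expectation_random_subset_insert integrable_random_subset)
  then have "p * ?e' = p * (1 - p) + (1 - p) * (p * ?e)"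
    by (simp only:) (simp add: algebra_simps)
  also have "\<dots> \<le> p * (1 - p) + (1 - p) * 1"
    using insert.IH assms(4) by (intro add_left_mono mult_left_mono) auto
  also have "\<dots> = 1 - p * p"
    by (simp add: algebra_simps)
  finally show ?case
    by (smt (verit) zero_le_square)
qed

text \<open>The weight \<open>1 + p\<close> is \<open>1 + p' / 2\<close> for the next success
  probability \<open>p' = 2 * p\<close>. The induction closes because \<open>p * (3 / 2) + (1 - p) *
  (1 + p) * 3 = 3 * (1 + p / 2) - 3 * p\<^sup>2\<close>.\<close>

lemma expectation_power_card_above:
  assumes "finite F" "inj_on v F" "0 \<le> p" "p \<le> 1"
  shows "measure_pmf.expectation (random_subset F p)
      (\<lambda>S. (3 / 2) ^ card S * (1 + p) ^ card (above v F S)) \<le> 3 * (1 + p / 2) ^ card F"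
  using assms(1,2)
proof (induction rule: inj_on_max_induct)
  case empty
  then show ?case by (simp add: random_subset_empty above_def)
next
  case (insert x A)
  let ?E = "measure_pmf.expectation (random_subset A p)"
  let ?f = "\<lambda>F S. (3 / 2 :: real) ^ card S * (1 + p) ^ card (above v F S)"
  let ?u = "(1 + p / 2) ^ card A"
  have sub: "S \<subseteq> A" if "S \<in> set_pmf (random_subset A p)" for S
    using that set_random_subset by blast
  have "?E (\<lambda>S. ?f (insert x A) (insert x S)) = ?E (\<lambda>S. 3 / 2 * (3 / 2) ^ card S)"
    by (rule expectation_pmf_cong)
       (simp add: above_insert_max(1) card_insert_random_subset[OF insert.hyps(1,2)] insert.hyps sub)
  \<comment> \<open>The generating function at \<open>3 / 2\<close> has base
    \<open>1 + p * (3 / 2 - 1) = 1 + p / 2\<close>; this explains the base in the potential.\<close>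
  also have "\<dots> = 3 / 2 * ?u"
    using insert.hyps assms(3,4) by (simp add: expectation_power_card_random_subset)
  finally have hit: "?E (\<lambda>S. ?f (insert x A) (insert x S)) = 3 / 2 * ?u" .
  have "?E (\<lambda>S. ?f (insert x A) S) = ?E (\<lambda>S. (1 + p) * ?f A S)"
    by (rule expectation_pmf_cong) (simp add: card_above_insert_max insert.hyps sub)
  also have "\<dots> \<le> (1 + p) * (3 * ?u)"
    using insert.IH assms(3) by (simp only: integral_mult_right_zero) (intro mult_left_mono, auto)
  finally have miss: "?E (\<lambda>S. ?f (insert x A) S) \<le> (1 + p) * (3 * ?u)" .
  have "measure_pmf.expectation (random_subset (insert x A) p) (?f (insert x A))
      = p * (3 / 2 * ?u) + (1 - p) * ?E (\<lambda>S. ?f (insert x A) S)"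
    using hit insert.hyps assms(3,4) by (simp add: expectation_random_subset_insert)
  also have "\<dots> \<le> p * (3 / 2 * ?u) + (1 - p) * ((1 + p) * (3 * ?u))"
    using miss assms(4) by (intro add_left_mono mult_left_mono) auto
  also have "\<dots> = 3 * (1 + p / 2) ^ card (insert x A) - 3 * p\<^sup>2 * ?u"
    using insert.hyps(1,2) by (simp add: algebra_simps power2_eq_square)
  also have "\<dots> \<le> 3 * (1 + p / 2) ^ card (insert x A)"
    using assms(3) by simp
  finally show ?case .
qed

section \<open>One round of the protocol in terms of random subsets\<close>

lemma maximum_round_random_subset:
  "maximum_round N v r s
     = map_pmf (\<lambda>S. send v S s) (random_subset (flipping v s) (2 ^ r / real N))"
  by (simp add: maximum_round_def random_subset_def pmf.map_comp o_def)

lemma flipping_iff: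
  "i \<in> flipping v s \<longleftrightarrow> i \<in> active s \<and> (\<forall>m \<in># received s. snd m \<le> v i)"
  by (auto simp: flipping_def broadcast_max_def not_less)

text \<open>A node flips again if it did not send and no value just sent exceeds its own. As values
  are distinct, it then lies strictly above all of them; conversely, no member of \<open>S\<close>
  is strictly above itself.\<close>

lemma flipping_send:
  assumes "inj_on v (active s)" "finite S" "S \<subseteq> flipping v s"
  shows "flipping v (send v S s) = above v (flipping v s) S"
proof -
  have *: "v j \<noteq> v i" if "i \<in> active s" "i \<notin> S" "j \<in> S" for i j
    using that assms by (metis flipping_iff inj_on_contraD subsetD)
  show ?thesis
    using assms(2) by (fastforce simp: flipping_iff above_def send_def less_le ball_Un *)
qed

lemma messages_send: "finite S \<Longrightarrow> messages (send v S s) = messages s + card S"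
  by (simp add: messages_def send_def)

text \<open>Both potentials depend on the state only through the number of messages and of flipping
  nodes, so a round can be analysed by the random subset alone.\<close>

lemma expectation_maximum_round:
  assumes "finite (active s)" "inj_on v (active s)"
  shows "measure_pmf.expectation (maximum_round N v r s) (\<lambda>t. f (messages t) (card (flipping v t)))
    = measure_pmf.expectation (random_subset (flipping v s) (2 ^ r / real N))
        (\<lambda>S. f (messages s + card S) (card (above v (flipping v s) S)) :: real)"
proof -
  have fin: "finite (flipping v s)"
    using assms(1) by (simp add: flipping_def)
  show ?thesis
    unfolding maximum_round_random_subset integral_map_pmf
  proof (rule expectation_pmf_cong)
    fix S assume "S \<in> set_pmf (random_subset (flipping v s) (2 ^ r / real N))"
    then have "S \<subseteq> flipping v s"
      using set_random_subset by blast
    then show "f (messages (send v S s)) (card (flipping v (send v S s)))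
        = f (messages s + card S) (card (above v (flipping v s) S))"
      using assms fin by (simp add: flipping_send messages_send finite_subset)
  qed
qed

lemma active_run_rounds: "s \<in> set_pmf (run_rounds N n v k) \<Longrightarrow> active s \<subseteq> {1..n}"
proof (induction k arbitrary: s)
  case 0
  then show ?case by (simp add: initial_state_def)
next
  case (Suc k)
  then show ?case
    by (auto simp: maximum_round_def send_def) (use Suc.IH in fastforce)+
qed

lemma flipping_initial_state: "flipping v (initial_state n) = {1..n}"
  by (auto simp: flipping_iff initial_state_def)

lemma finite_set_maximum_round: "finite (active s) \<Longrightarrow> finite (set_pmf (maximum_round N v r s))"
  by (simp add: maximum_round_random_subset finite_set_random_subset flipping_def)

section \<open>Potentials along the run and the expected number of messages\<close>

context
  fixes N n :: nat and v :: "nat \<Rightarrow> real"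
  assumes N: "1 \<le> N" and n: "n \<le> N" and inj: "inj_on v {1..n}"
begin

lemma run_rounds_state:
  assumes "s \<in> set_pmf (run_rounds N n v k)"
  shows "finite (active s)" "inj_on v (active s)" "finite (flipping v s)" "inj_on v (flipping v s)"
proof -
  show "finite (active s)" "inj_on v (active s)"
    using active_run_rounds[OF assms] inj by (auto intro: finite_subset inj_on_subset)
  then show "finite (flipping v s)" "inj_on v (flipping v s)"
    by (auto simp: flipping_def intro: inj_on_subset)
qed

lemma success_probability_le_1:
  assumes "k < Suc (nat \<lfloor>log 2 (real N)\<rfloor>)"
  shows "2 ^ k / real N \<le> 1"
proof -
  have "real k \<le> log 2 (real N)"
    using assms N by (simp add: less_Suc_eq_le le_nat_floor le_nat_iff le_floor_iff)
  then have "2 powr real k \<le> real N"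
    using N by (simp add: le_log_iff)
  then show ?thesis
    using N by (simp add: powr_realpow)
qed

lemma expectation_potential:
  assumes "k \<le> Suc (nat \<lfloor>log 2 (real N)\<rfloor>)"
  shows "measure_pmf.expectation (run_rounds N n v k)
      (\<lambda>s. real (messages s) + 2 ^ k / real N * real (card (flipping v s))) \<le> 2 * real k + 1"
  using assms
proof (induction k)
  case 0
  \<comment> \<open>Initially there are no messages and all \<open>n\<close> nodes flip, so the
    potential is \<open>n / N \<le> 1\<close>.\<close>
  then show ?case
    using N n by (simp add: flipping_initial_state) (simp add: messages_def initial_state_def)
next
  case (Suc k)
  define p where "p = 2 ^ k / real N"
  have p: "0 \<le> p" "p \<le> 1"
    using success_probability_le_1[of k] Suc.prems by (auto simp: p_def)
  let ?M = "run_rounds N n v k"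
  have "measure_pmf.expectation (run_rounds N n v (Suc k))
      (\<lambda>s. real (messages s) + 2 * p * real (card (flipping v s)))
    \<le> measure_pmf.expectation ?M (\<lambda>s. (real (messages s) + p * real (card (flipping v s))) + 2)"
    unfolding run_rounds.simps
  proof (rule expectation_bind_pmf_le)
    fix s assume s: "s \<in> set_pmf ?M"
    note st = run_rounds_state[OF s]
    show "finite (set_pmf (maximum_round N v k s))"
      by (rule finite_set_maximum_round) (rule st)
    let ?R = "random_subset (flipping v s) p"
    have "measure_pmf.expectation (maximum_round N v k s)
        (\<lambda>t. real (messages t) + 2 * p * real (card (flipping v t)))
      = measure_pmf.expectation ?R (\<lambda>S. real (messages s + card S)
          + 2 * p * real (card (above v (flipping v s) S)))"
      unfolding p_def
      by (rule expectation_maximum_round[OF st(1,2), of N k "\<lambda>m g. real m + 2 * (2 ^ k / real N) * real g"])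
    \<comment> \<open>The expected number of new messages, \<open>p * card F\<close>, is exactly the
      second summand of the old potential; only the new second summand remains to be paid
      for.\<close>
    also have "\<dots> = real (messages s) + p * real (card (flipping v s))
        + 2 * (p * measure_pmf.expectation ?R (\<lambda>S. real (card (above v (flipping v s) S))))"
      using st p by (simp add: integrable_random_subset expectation_card_random_subset)
    also have "\<dots> \<le> real (messages s) + p * real (card (flipping v s)) + 2"
      using expectation_card_above[OF st(3,4) p] by simp
    finally show "measure_pmf.expectation (maximum_round N v k s)
        (\<lambda>t. real (messages t) + 2 * p * real (card (flipping v t))) \<le> \<dots>" .
  qed (use run_rounds_finite in blast)
  also have "\<dots> = measure_pmf.expectation ?M
      (\<lambda>s. real (messages s) + p * real (card (flipping v s))) + 2"
    using run_rounds_finite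
    by (subst Bochner_Integration.integral_add) (auto intro!: integrable_measure_pmf_finite)
  also have "\<dots> \<le> 2 * real (Suc k) + 1"
    using Suc by (simp add: p_def)
  finally show ?case
    by (simp add: p_def)
qed

text \<open>
  The last round is charged its expected number of successes only, not the increase \<open>2\<close> of the
  potential: this gives the additive constant \<open>1\<close>.
\<close>

lemma expectation_messages:
  "measure_pmf.expectation (maximum_protocol N n v) (\<lambda>s. real (messages s)) \<le> 2 * log 2 (real N) + 1"
proof -
  define k where "k = nat \<lfloor>log 2 (real N)\<rfloor>"
  define p where "p = 2 ^ k / real N"
  have p: "0 \<le> p" "p \<le> 1"
    using success_probability_le_1[of k] by (auto simp: p_def k_def)
  let ?M = "run_rounds N n v k"
  have "measure_pmf.expectation (run_rounds N n v (Suc k)) (\<lambda>s. real (messages s))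
      \<le> measure_pmf.expectation ?M (\<lambda>s. real (messages s) + p * real (card (flipping v s)))"
    unfolding run_rounds.simps
  proof (rule expectation_bind_pmf_le)
    fix s assume s: "s \<in> set_pmf ?M"
    note st = run_rounds_state[OF s]
    show "finite (set_pmf (maximum_round N v k s))"
      by (rule finite_set_maximum_round) (rule st)
    show "measure_pmf.expectation (maximum_round N v k s) (\<lambda>t. real (messages t))
        \<le> real (messages s) + p * real (card (flipping v s))"
      using expectation_maximum_round[OF st(1,2), of N k "\<lambda>m g. real m"] st p
      by (simp add: integrable_random_subset expectation_card_random_subset flip: p_def)
  qed (use run_rounds_finite in blast)
  also have "\<dots> \<le> 2 * real k + 1"
    using expectation_potential[of k] by (simp add: p_def k_def)
  also have "\<dots> \<le> 2 * log 2 (real N) + 1"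
    using N by (simp add: k_def)
  finally show ?thesis
    by (simp add: maximum_protocol_def k_def)
qed

section \<open>Exponential moment and tail bound\<close>

lemma expectation_exponential_potential:
  assumes "k \<le> Suc (nat \<lfloor>log 2 (real N)\<rfloor>)"
  shows "measure_pmf.expectation (run_rounds N n v k)
      (\<lambda>s. (3 / 2) ^ messages s * (1 + 2 ^ k / real N / 2) ^ card (flipping v s)) \<le> 2 * 3 ^ k"
  using assms
proof (induction k)
  case 0
  \<comment> \<open>The initial factor 2 comes from
    \<open>(1 + 1 / (2 * N)) ^ N \<le> exp (1 / 2) \<le> 2\<close>.\<close>
  have "(1 + 1 / (2 * real N)) ^ n \<le> (1 + 1 / (2 * real N)) ^ N"
    using n by (intro power_increasing) auto
  also have "\<dots> \<le> exp (1 / (2 * real N)) ^ N"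
    by (intro power_mono) (auto simp: exp_ge_add_one_self)
  also have "\<dots> = exp (1 / 2)"
    using N by (simp flip: exp_of_nat_mult)
  also have "\<dots> \<le> 2"
    using exp_bound_half[of "1 / 2 :: real"] by simp
  finally show ?case
    by (simp add: flipping_initial_state mult.commute) (simp add: messages_def initial_state_def)
next
  case (Suc k)
  define p where "p = 2 ^ k / real N"
  have p: "0 \<le> p" "p \<le> 1"
    using success_probability_le_1[of k] Suc.prems by (auto simp: p_def)
  let ?M = "run_rounds N n v k"
  \<comment> \<open>The base for \<open>Suc k\<close> is
    \<open>1 + 2 ^ Suc k / N / 2 = 1 + p\<close>, which matches the one-round estimate.\<close>
  have "measure_pmf.expectation (run_rounds N n v (Suc k))
      (\<lambda>s. (3 / 2) ^ messages s * (1 + p) ^ card (flipping v s))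
    \<le> measure_pmf.expectation ?M (\<lambda>s. 3 * ((3 / 2) ^ messages s * (1 + p / 2) ^ card (flipping v s)))"
    unfolding run_rounds.simps
  proof (rule expectation_bind_pmf_le)
    fix s assume s: "s \<in> set_pmf ?M"
    note st = run_rounds_state[OF s]
    show "finite (set_pmf (maximum_round N v k s))"
      by (rule finite_set_maximum_round) (rule st)
    let ?R = "random_subset (flipping v s) p"
    have "measure_pmf.expectation (maximum_round N v k s)
        (\<lambda>t. (3 / 2) ^ messages t * (1 + p) ^ card (flipping v t))
      = measure_pmf.expectation ?R (\<lambda>S. (3 / 2) ^ (messages s + card S)
          * (1 + p) ^ card (above v (flipping v s) S))"
      unfolding p_def
      by (rule expectation_maximum_round[OF st(1,2), of N k "\<lambda>m g. (3 / 2) ^ m * (1 + 2 ^ k / real N) ^ g"])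
    also have "\<dots> = (3 / 2) ^ messages s * measure_pmf.expectation ?R
        (\<lambda>S. (3 / 2) ^ card S * (1 + p) ^ card (above v (flipping v s) S))"
      by (simp add: power_add mult.assoc)
    also have "\<dots> \<le> (3 / 2) ^ messages s * (3 * (1 + p / 2) ^ card (flipping v s))"
      by (intro mult_left_mono expectation_power_card_above st p) simp
    finally show "measure_pmf.expectation (maximum_round N v k s)
        (\<lambda>t. (3 / 2) ^ messages t * (1 + p) ^ card (flipping v t))
      \<le> 3 * ((3 / 2) ^ messages s * (1 + p / 2) ^ card (flipping v s))"
      by simp
  qed (use run_rounds_finite in blast)
  also have "\<dots> = 3 * measure_pmf.expectation ?M
      (\<lambda>s. (3 / 2) ^ messages s * (1 + p / 2) ^ card (flipping v s))"
    by simp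
  also have "\<dots> \<le> 2 * 3 ^ Suc k"
    using Suc by (simp add: p_def)
  finally show ?case
    by (simp add: p_def)
qed

lemma expectation_power_messages:
  assumes "2 \<le> N"
  shows "measure_pmf.expectation (maximum_protocol N n v) (\<lambda>s. (3 / 2) ^ messages s)
    \<le> 27 powr log 2 (real N)"
proof -
  define k where "k = nat \<lfloor>log 2 (real N)\<rfloor>"
  let ?l = "log 2 (real N)"
  have l: "1 \<le> ?l"
    using assms by (simp add: le_log_iff)
  \<comment> \<open>The factor for the flipping nodes is at least 1, so the potential dominates the
    moment.\<close>
  have "measure_pmf.expectation (maximum_protocol N n v) (\<lambda>s. (3 / 2) ^ messages s)
      \<le> measure_pmf.expectation (run_rounds N n v (Suc k))
        (\<lambda>s. (3 / 2) ^ messages s * (1 + 2 ^ Suc k / real N / 2) ^ card (flipping v s))"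
    unfolding maximum_protocol_def k_def[symmetric]
  proof (rule expectation_pmf_mono)
    show "finite (set_pmf (run_rounds N n v (Suc k)))"
      using run_rounds_finite by blast
    fix s
    have "1 \<le> (1 + 2 ^ Suc k / real N / 2) ^ card (flipping v s)"
      by (rule one_le_power) simp
    then show "(3 / 2) ^ messages s
        \<le> (3 / 2) ^ messages s * (1 + 2 ^ Suc k / real N / 2) ^ card (flipping v s)"
      by (intro mult_le_cancel_left1[THEN iffD2]) auto
  qed
  also have "\<dots> \<le> 2 * 3 ^ Suc k"
    by (rule expectation_exponential_potential) (simp add: k_def)
  also have "\<dots> = 6 * 3 powr real k"
    by (simp add: powr_realpow)
  \<comment> \<open>From \<open>N \<ge> 2\<close> follows \<open>?l \<ge> 1\<close>, so the constant
    6 is absorbed into \<open>9 powr ?l\<close>.\<close>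
  also have "\<dots> \<le> 9 powr ?l * 3 powr ?l"
  proof (intro mult_mono powr_mono)
    have "6 \<le> (9 :: real) powr 1" by simp
    also have "\<dots> \<le> 9 powr ?l" using l by (intro powr_mono) auto
    finally show "6 \<le> 9 powr ?l" .
    show "real k \<le> ?l" using l by (simp add: k_def)
  qed auto
  also have "\<dots> = 27 powr ?l"
    by (simp flip: powr_mult)
  finally show ?thesis .
qed

text \<open>The factor \<open>27\<close> in the constant cancels the moment bound
  \<open>27 powr log 2 N\<close>, and \<open>2 powr c\<close> leaves the failure probability, since
  \<open>(2 powr c) powr log 2 N = N powr c\<close>.\<close>

lemma prob_messages:
  fixes c :: real
  shows "1 - real N powr (- c) \<le> measure_pmf.prob (maximum_protocol N n v)
    {s. real (messages s) \<le> log (3 / 2) (27 * 2 powr c) * log 2 (real N)}"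
proof (cases "N = 1")
  case True
  \<comment> \<open>For \<open>N = 1\<close> the claimed lower bound is
    \<open>1 - 1 = 0\<close>.\<close>
  then show ?thesis by simp
next
  case False
  define M where "M = maximum_protocol N n v"
  let ?l = "log 2 (real N)"
  define C where "C = log (3 / 2) (27 * 2 powr c)"
  let ?A = "{s. real (messages s) \<le> C * ?l}"
  \<comment> \<open>By the choice of \<open>C\<close>, this is \<open>(3 / 2) powr (C * ?l)\<close>,
    the Markov threshold for \<open>(3 / 2) ^ messages s\<close>.\<close>
  define D where "D = (27 * 2 powr c) powr ?l"
  have D: "D = 27 powr ?l * real N powr c"
  proof -
    have "(2 powr c) powr ?l = (2 powr ?l) powr c"
      by (simp add: powr_powr mult.commute)
    then show ?thesis
      using N by (simp add: D_def powr_mult)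
  qed
  have Dpos: "0 < D" using N by (simp add: D)
  have fin: "finite (set_pmf M)"
    unfolding M_def maximum_protocol_def using run_rounds_finite by blast
  have "measure_pmf.prob M (- ?A) = measure_pmf.expectation M (indicator (- ?A))"
    by simp
  \<comment> \<open>Markov's inequality: the quotient is nonnegative, and at least 1 outside
    \<open>?A\<close>.\<close>
  also have "\<dots> \<le> measure_pmf.expectation M (\<lambda>s. (3 / 2) ^ messages s / D)"
  proof (rule expectation_pmf_mono[OF fin])
    fix s
    show "indicator (- ?A) s \<le> (3 / 2) ^ messages s / D"
    proof (cases "s \<in> ?A")
      case True
      then show ?thesis using Dpos by simp
    next
      case False
      have "(3 / 2 :: real) powr C = 27 * 2 powr c"
        unfolding C_def by (rule powr_log_cancel) auto
      then have "D = (3 / 2) powr (C * ?l)"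
        unfolding D_def by (simp add: powr_powr[symmetric])
      also have "\<dots> \<le> (3 / 2) powr real (messages s)"
        using False by (intro powr_mono) auto
      finally have "D \<le> (3 / 2) ^ messages s"
        by (simp add: powr_realpow)
      then show ?thesis using Dpos False by simp
    qed
  qed
  also have "\<dots> = measure_pmf.expectation M (\<lambda>s. (3 / 2) ^ messages s) / D"
    by simp
  also have "\<dots> \<le> 27 powr ?l / D"
    using expectation_power_messages False N Dpos
    by (intro divide_right_mono) (auto simp: M_def)
  also have "\<dots> = real N powr (- c)"
    by (simp add: D powr_minus_divide)
  finally have "measure_pmf.prob M (- ?A) \<le> real N powr (- c)" .
  moreover have "measure_pmf.prob M (- ?A) = 1 - measure_pmf.prob M ?A"
    using measure_pmf.prob_compl[of ?A M] by (simp add: Compl_eq_Diff_UNIV)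
  ultimately show ?thesis
    by (simp add: M_def C_def)
qed

end

theorem theorem2:
  "(\<forall>(n::nat) (N::nat) (v :: nat \<Rightarrow> real).
      1 \<le> N \<and> n \<le> N \<and> inj_on v {1..n} \<longrightarrow>
      measure_pmf.expectation (maximum_protocol N n v) (\<lambda>s. real (messages s))
        \<le> 2 * log 2 (real N) + 1)
   \<and>
   (\<forall>c::real. c > 1 \<longrightarrow>
      (\<exists>C::real. C > 0 \<and>
        (\<forall>(n::nat) (N::nat) (v :: nat \<Rightarrow> real).
           1 \<le> N \<and> n \<le> N \<and> inj_on v {1..n} \<longrightarrow>
           measure_pmf.prob (maximum_protocol N n v)
             {s. real (messages s) \<le> C * log 2 (real N)}
             \<ge> 1 - real N powr (- c))))"
proof (intro conjI allI impI)
  fix n N :: nat and v :: "nat \<Rightarrow> real"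
  assume "1 \<le> N \<and> n \<le> N \<and> inj_on v {1..n}"
  then show "measure_pmf.expectation (maximum_protocol N n v) (\<lambda>s. real (messages s))
      \<le> 2 * log 2 (real N) + 1"
    using expectation_messages by blast
next
  fix c :: real
  assume c: "c > 1"
  \<comment> \<open>The witness for \<open>C\<close> depends on \<open>c\<close> only; it is
    positive because the argument of the logarithm exceeds 1.\<close>
  have "1 \<le> 2 powr c"
    using c by (intro ge_one_powr_ge_zero) auto
  then have pos: "0 < log (3 / 2) (27 * 2 powr c)"
    by simp
  show "\<exists>C>0. \<forall>n N v. 1 \<le> N \<and> n \<le> N \<and> inj_on v {1..n} \<longrightarrow>
      1 - real N powr (- c)
        \<le> measure_pmf.prob (maximum_protocol N n v) {s. real (messages s) \<le> C * log 2 (real N)}"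
    using prob_messages pos by blast
qed

end
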